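(* Let $r$ be a complex number and $n\ge1$ an integer. Then, as polynomials in $x$, $$\sum_{k=0}^{n-1}(2k+2r+1)\prod_{s=k+1}^n s(s+2r)\, D_k^{(r)}(x)^2 =n(n+2r)\big(D_n^{(r)}(x)^2-D_{n-1}^{(r)}(x)D_{n+1}^{(r)}(x)\big).$$ Consequently, if $r>-\tfrac12$ is real, then $D_n^{(r)}(x)^2-D_{n+1}^{(r)}(x)D_{n-1}^{(r)}(x)>0$ for every real $x$.
   Context: For a parameter $r$, the polynomials $D_n^{(r)}(x)$ are defined by $D_{-1}^{(r)}(x)=0$, $D_0^{(r)}(x)=1$ and $D_{n+1}^{(r)}(x)=xD_n^{(r)}(x)-n(n+2r)D_{n-1}^{(r)}(x)$ for $n\ge0$. *)

theory Defs
  imports Complex_Main "HOL-Computational_Algebra.Polynomial"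
begin

text \<open>
  \<open>Dpoly r n\<close> is the polynomial \<open>D\<^sub>n\<close> with parameter \<open>r\<close>.  The index \<open>-1\<close> is not a natural
  number, so the convention that \<open>D\<close> vanishes there appears as the first branch of the case
  expression.  The coefficient ring is kept general so that the same definition serves complex
  and real parameters.
\<close>

fun Dpoly :: "'a::comm_ring_1 \<Rightarrow> nat \<Rightarrow> 'a poly" where
  "Dpoly r 0 = 1"
| "Dpoly r (Suc n) = [:0, 1:] * Dpoly r n
     - smult (of_nat n * (of_nat n + 2 * r)) (case n of 0 \<Rightarrow> 0 | Suc m \<Rightarrow> Dpoly r m)"

text \<open>
  For a real parameter, evaluating the real polynomial agrees with evaluating the complex one.
\<close>

lemma poly_Dpoly_of_real:
  fixes r x :: real
  shows "poly (Dpoly (complex_of_real r) n) (complex_of_real x) = complex_of_real (poly (Dpoly r n) x)"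
  by (induction r n rule: Dpoly.induct) (auto split: nat.splits)

end

theory Submission imports Defs begin

text \<open>
  Put \<open>a\<^sub>n = n (n + 2 r)\<close>. Applying the three-term recurrence to \<open>D\<^sub>n\<^sub>+\<^sub>2\<close> and then to
  \<open>D\<^sub>n\<^sub>+\<^sub>1 - x D\<^sub>n\<close>, the Turan determinants \<open>T\<^sub>n = D\<^sub>n\<^sup>2 - D\<^sub>n\<^sub>-\<^sub>1 D\<^sub>n\<^sub>+\<^sub>1\<close> satisfy
  \<open>T\<^sub>n\<^sub>+\<^sub>1 = (a\<^sub>n\<^sub>+\<^sub>1 - a\<^sub>n) D\<^sub>n\<^sup>2 + a\<^sub>n T\<^sub>n\<close>, where \<open>a\<^sub>n\<^sub>+\<^sub>1 - a\<^sub>n = 2 n + 2 r + 1\<close>.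
  Iterating this gives the sum formula, and it propagates positivity from
  \<open>T\<^sub>1 = 1 + 2 r\<close> since \<open>a\<^sub>n > 0\<close> for \<open>n \<ge> 1\<close> and \<open>r > -1/2\<close>.
\<close>

text \<open>
  The case \<open>n = 0\<close> is included: there the truncated index \<open>n - 1\<close> is harmless because its
  coefficient vanishes.
\<close>

lemma Dpoly_Suc:
  "Dpoly r (Suc n) = [:0, 1:] * Dpoly r n - smult (of_nat n * (of_nat n + 2 * r)) (Dpoly r (n - 1))"
  by (cases n) auto

lemma Dpoly_turan_Suc:
  fixes r :: "'a::comm_ring_1"
  shows "(Dpoly r (Suc n))\<^sup>2 - Dpoly r n * Dpoly r (Suc (Suc n)) =
      smult (2 * of_nat n + 2 * r + 1) ((Dpoly r n)\<^sup>2)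
    + smult (of_nat n * (of_nat n + 2 * r)) ((Dpoly r n)\<^sup>2 - Dpoly r (n - 1) * Dpoly r (Suc n))"
proof -
  define a :: "nat \<Rightarrow> 'a" where "a k = of_nat k * (of_nat k + 2 * r)" for k
  let ?D = "Dpoly r" and ?X = "[:0, 1:] :: 'a poly"
  have a_Suc: "a (Suc n) = (2 * of_nat n + 2 * r + 1) + a n"
    by (simp add: a_def algebra_simps)
  \<comment> \<open>The recurrence is solved for \<open>?X * ?D n\<close>, so that substituting it
    after \<open>D2\<close> removes the explicit variable.\<close>
  have D1: "?X * ?D n = ?D (Suc n) + smult (a n) (?D (n - 1))"
    using Dpoly_Suc[of r n] by (simp add: a_def)
  have D2: "?D (Suc (Suc n)) = ?X * ?D (Suc n) - smult (a (Suc n)) (?D n)"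
    using Dpoly_Suc[of r "Suc n"] by (simp add: a_def)
  have "?D n * ?D (Suc (Suc n)) = (?X * ?D n) * ?D (Suc n) - smult (a (Suc n)) ((?D n)\<^sup>2)"
    unfolding D2 by (simp only: right_diff_distrib mult_smult_right power2_eq_square mult_ac)
  also have "\<dots> = (?D (Suc n))\<^sup>2 + smult (a n) (?D (n - 1) * ?D (Suc n)) - smult (a (Suc n)) ((?D n)\<^sup>2)"
    unfolding D1 by (simp only: distrib_right mult_smult_left power2_eq_square)
  finally have "(?D (Suc n))\<^sup>2 - ?D n * ?D (Suc (Suc n)) =
      smult (a (Suc n)) ((?D n)\<^sup>2) - smult (a n) (?D (n - 1) * ?D (Suc n))"
    by (simp only: algebra_simps)
  then show ?thesis
    unfolding a_Suc a_def[of n, symmetric] by (simp only: smult_add_left smult_diff_right algebra_simps)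
qed

lemma Dpoly_turan_sum:
  fixes r :: "'a::comm_ring_1"
  shows "(\<Sum>k<n. smult ((2 * of_nat k + 2 * r + 1) * (\<Prod>s = Suc k..n. of_nat s * (of_nat s + 2 * r)))
                    ((Dpoly r k)\<^sup>2))
    = smult (of_nat n * (of_nat n + 2 * r)) ((Dpoly r n)\<^sup>2 - Dpoly r (n - 1) * Dpoly r (Suc n))"
proof (induction n)
  case 0
  show ?case by simp
next
  case (Suc n)
  define a :: "nat \<Rightarrow> 'a" where "a k = of_nat k * (of_nat k + 2 * r)" for k
  let ?c = "\<lambda>k. 2 * of_nat k + 2 * r + 1 :: 'a" and ?D = "Dpoly r"
  let ?S = "\<lambda>m. \<Sum>k<n. smult (?c k * (\<Prod>s = Suc k..m. a s)) ((?D k)\<^sup>2)"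
  \<comment> \<open>Raising the upper limit of the products adds the same factor
    \<open>a (Suc n)\<close> to every summand. The new term \<open>k = n\<close> has only this
    factor, so it can be pulled out of the whole sum.\<close>
  have "?S (Suc n) = smult (a (Suc n)) (?S n)"
    by (rule poly_eqI) (simp add: coeff_sum sum_distrib_left prod.nat_ivl_Suc' mult_ac)
  then have "(\<Sum>k<Suc n. smult (?c k * (\<Prod>s = Suc k..Suc n. a s)) ((?D k)\<^sup>2))
      = smult (a (Suc n)) (?S n + smult (?c n) ((?D n)\<^sup>2))"
    by (simp add: smult_add_right mult_ac)
  also have "?S n + smult (?c n) ((?D n)\<^sup>2) = (?D (Suc n))\<^sup>2 - ?D n * ?D (Suc (Suc n))"
    using Suc.IH unfolding Dpoly_turan_Suc[of r n] a_def by (simp only: add.commute)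
  finally show ?case by (simp only: a_def diff_Suc_1)
qed

text \<open>Indexing by \<open>Suc n\<close> starts the induction at the constant
  \<open>1 + 2 * r\<close> and avoids the index 0, where the factor \<open>a\<close>
  vanishes.\<close>

lemma Dpoly_turan_pos:
  fixes r x :: "'a::linordered_field"
  assumes "r > - 1 / 2"
  shows "(poly (Dpoly r (Suc n)) x)\<^sup>2 - poly (Dpoly r n) x * poly (Dpoly r (Suc (Suc n))) x > 0"
proof (induction n)
  case 0
  show ?case using assms by (simp add: power2_eq_square field_simps)
next
  case (Suc n)
  have "of_nat (Suc n) + 2 * r > 0"
    using add_nonneg_pos[OF of_nat_0_le_iff[of n], of "1 + 2 * r"] assms
    by (simp add: field_simps)
  then have a_pos: "of_nat (Suc n) * (of_nat (Suc n) + 2 * r) > 0"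
    by (intro mult_pos_pos) (simp_all del: of_nat_Suc)
  have c_nonneg: "2 * of_nat (Suc n) + 2 * r + 1 \<ge> 0"
    using \<open>of_nat (Suc n) + 2 * r > 0\<close> of_nat_0_le_iff[of "Suc n", where 'a = 'a] by linarith
  have "(poly (Dpoly r (Suc (Suc n))) x)\<^sup>2
        - poly (Dpoly r (Suc n)) x * poly (Dpoly r (Suc (Suc (Suc n)))) x
      = (2 * of_nat (Suc n) + 2 * r + 1) * (poly (Dpoly r (Suc n)) x)\<^sup>2
        + of_nat (Suc n) * (of_nat (Suc n) + 2 * r)
          * ((poly (Dpoly r (Suc n)) x)\<^sup>2 - poly (Dpoly r n) x * poly (Dpoly r (Suc (Suc n))) x)"
    using arg_cong[OF Dpoly_turan_Suc[of r "Suc n"], of "\<lambda>p. poly p x"]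
    by (simp only: poly_diff poly_add poly_mult poly_power poly_smult diff_Suc_1)
  \<comment> \<open>The square may vanish at \<open>x\<close>, so strictness comes from the second
    summand.\<close>
  then show ?case
    using add_nonneg_pos[OF mult_nonneg_nonneg[OF c_nonneg zero_le_power2] mult_pos_pos[OF a_pos Suc.IH]]
    by (simp only:)
qed

theorem theorem3p1:
  fixes n :: nat
  assumes "n \<ge> 1"
  shows "(\<forall>r::complex.
      (\<Sum>k = 0..n - 1. smult ((2 * of_nat k + 2 * r + 1) * (\<Prod>s = k + 1..n. of_nat s * (of_nat s + 2 * r)))
                          ((Dpoly r k)\<^sup>2))
      = smult (of_nat n * (of_nat n + 2 * r))
          ((Dpoly r n)\<^sup>2 - Dpoly r (n - 1) * Dpoly r (n + 1)))
    \<and> (\<forall>r::real. r > - 1 / 2 \<longrightarrow>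
        (\<forall>x::real. (poly (Dpoly r n) x)\<^sup>2 - poly (Dpoly r (n + 1)) x * poly (Dpoly r (n - 1)) x > 0))"
proof -
  from assms obtain m where n: "n = Suc m"
    by (cases n) auto
  have range: "{0..n - 1} = {..<n}"
    unfolding n by auto
  show ?thesis
  proof (intro conjI allI impI)
    fix r :: complex
    show "(\<Sum>k = 0..n - 1. smult ((2 * of_nat k + 2 * r + 1) * (\<Prod>s = k + 1..n. of_nat s * (of_nat s + 2 * r)))
                          ((Dpoly r k)\<^sup>2))
      = smult (of_nat n * (of_nat n + 2 * r))
          ((Dpoly r n)\<^sup>2 - Dpoly r (n - 1) * Dpoly r (n + 1))"
      unfolding range using Dpoly_turan_sum[of r n] by (simp only: Suc_eq_plus1)
  next
    fix r x :: real
    assume "r > - 1 / 2"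
    then show "(poly (Dpoly r n) x)\<^sup>2 - poly (Dpoly r (n + 1)) x * poly (Dpoly r (n - 1)) x > 0"
      using Dpoly_turan_pos[of r m x] unfolding n by (simp only: Suc_eq_plus1 diff_add_inverse2 mult.commute)
  qed
qed

end
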